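(* Let $\lambda/\mu$ be a skew partition and let $\mathbf{D}=\{\theta_1,\ldots,\theta_k\}$ be any outside decomposition of $\lambda/\mu$. Let $G^{\mathbf{D}}_{\lambda/\mu}=\left(s_{[\tau(p(\theta_i)),\tau(q(\theta_j))]}\right)_{i,j=1}^k$ and let $\mathrm{grank}_{\mathbf{D}}(\lambda/\mu)$ be the number of rows of $G^{\mathbf{D}}_{\lambda/\mu}$ that contain no entry equal to $1$. Then $\mathrm{grank}_{\mathbf{D}}(\lambda/\mu)=\mathrm{rank}(\lambda/\mu)$.
   Context: Squares $(i,j)$ of Young diagrams (English convention) have content $\tau(i,j)=j-i$. The rank of a skew partition: a square $(i,j)$ is an inner corner of $\lambda/\mu$ if $(i,j),(i,j-1),(i-1,j)\in\lambda/\mu$ but $(i-1,j-1)\notin\lambda/\mu$, and an outer corner if $(i,j)\in\lambda/\mu$ but $(i-1,j-1),(i,j-1),(i-1,j)\notin\lambda/\mu$; the diagonal of such a corner consists of the squares $(i+p,j+p)\in\lambda/\mu$, $p\ge0$; $\mathrm{rank}(\lambda/\mu)=d^+-d^-$ where $d^+$ (resp. $d^-$) is the total number of squares on diagonals of outer (resp. inner) corners. A border strip is a connected skew diagram containing no $2\times 2$ square. A decomposition of $\lambda/\mu$ into disjoint border strips is an outside decomposition if every strip starts at a square on the left or bottom perimeter of the diagram and ends at a square on the right or top perimeter. For a strip $\theta$, $p(\theta)$ is its lower-left (starting) square and $q(\theta)$ its upper-right (ending) square. Suppose the squares of $\lambda/\mu$ have $k'$ distinct contents $c_1<c_2<\cdots<c_{k'}$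 (the diagonals). In an outside decomposition, each square not at the end of its strip has direction "up" or "right" according as the next square of its strip lies above it or to its right; all squares on the same diagonal have the same direction. The cutting strip $\phi$ is the border strip of $k'$ squares, the $i$-th of which is assigned content $c_i$, such that for $i=1,\ldots,k'-1$ the $(i+1)$-th square lies above (resp. to the right of) the $i$-th exactly when the $i$-th diagonal has direction up (resp. right). For integers $\alpha,\beta$: if $\alpha\le\beta$, $[\alpha,\beta]$ is the segment of $\phi$ from the square of content $\alpha$ to the square of content $\beta$ and $s_{[\alpha,\beta]}$ is the skew Schur function of this border strip shape; if $\alpha=\beta+1$, $s_{[\alpha,\beta]}=1$; if $\alpha>\beta+1$, $s_{[\alpha,\beta]}=0$. (Hamel–Goulden: $s_{\lambda/\mu}=\det G^{\mathbf{D}}_{\lambda/\mu}$.) *)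

theory Defs
  imports "HOL-Library.Multiset" "HOL-Library.FuncSet" "HOL-Library.Disjoint_Sets"
    "Jordan_Normal_Form.Matrix"
begin

section \<open>Skew partitions\<close>

text \<open>Squares are (row, column), both counted from 1, in English convention: rows are numbered
  downwards and columns to the right.  Integers are used so that neighbours can be formed without
  truncated subtraction.\<close>

type_synonym square = "int \<times> int"

definition is_partition :: "nat list \<Rightarrow> bool" where
  "is_partition xs \<longleftrightarrow> sorted_wrt (\<ge>) xs \<and> 0 \<notin> set xs"

definition young_diagram :: "nat list \<Rightarrow> square set" where
  "young_diagram xs =
     {(i, j). 1 \<le> i \<and> i \<le> int (length xs) \<and> 1 \<le> j \<and> j \<le> int (xs ! nat (i - 1))}"

definition skew_partition :: "nat list \<Rightarrow> nat list \<Rightarrow> bool" where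
  "skew_partition lam mu \<longleftrightarrow>
     is_partition lam \<and> is_partition mu \<and> young_diagram mu \<subseteq> young_diagram lam"

definition skew_diagram :: "nat list \<Rightarrow> nat list \<Rightarrow> square set" where
  "skew_diagram lam mu = young_diagram lam - young_diagram mu"

definition is_skew_diagram :: "square set \<Rightarrow> bool" where
  "is_skew_diagram S \<longleftrightarrow> (\<exists>lam mu. skew_partition lam mu \<and> S = skew_diagram lam mu)"

fun content :: "square \<Rightarrow> int" where
  "content (i, j) = j - i"

fun above :: "square \<Rightarrow> square" where
  "above (i, j) = (i - 1, j)"

fun below :: "square \<Rightarrow> square" where
  "below (i, j) = (i + 1, j)"

fun left_of :: "square \<Rightarrow> square" where
  "left_of (i, j) = (i, j - 1)"

fun right_of :: "square \<Rightarrow> square" where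
  "right_of (i, j) = (i, j + 1)"


section \<open>Rank\<close>

definition inner_corners :: "square set \<Rightarrow> square set" where
  "inner_corners S =
     {(i, j). (i, j) \<in> S \<and> (i, j - 1) \<in> S \<and> (i - 1, j) \<in> S \<and> (i - 1, j - 1) \<notin> S}"

definition outer_corners :: "square set \<Rightarrow> square set" where
  "outer_corners S =
     {(i, j). (i, j) \<in> S \<and> (i - 1, j - 1) \<notin> S \<and> (i, j - 1) \<notin> S \<and> (i - 1, j) \<notin> S}"

fun corner_diagonal :: "square set \<Rightarrow> square \<Rightarrow> square set" where
  "corner_diagonal S (i, j) = {(i + p, j + p) | p. p \<ge> 0 \<and> (i + p, j + p) \<in> S}"

definition skew_rank :: "square set \<Rightarrow> int" where
  "skew_rank S = (\<Sum>x\<in>outer_corners S. int (card (corner_diagonal S x)))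
               - (\<Sum>x\<in>inner_corners S. int (card (corner_diagonal S x)))"


section \<open>Border strips and outside decompositions\<close>

definition adjacent :: "square \<Rightarrow> square \<Rightarrow> bool" where
  "adjacent x y \<longleftrightarrow> y \<in> {above x, below x, left_of x, right_of x}"

definition connected_squares :: "square set \<Rightarrow> bool" where
  "connected_squares S \<longleftrightarrow>
     (\<forall>x\<in>S. \<forall>y\<in>S. (x, y) \<in> {(a, b). a \<in> S \<and> b \<in> S \<and> adjacent a b}\<^sup>*)"

definition border_strip :: "square set \<Rightarrow> bool" where
  "border_strip S \<longleftrightarrow> is_skew_diagram S \<and> connected_squares S \<and>
     \<not> (\<exists>i j. {(i, j), (i, j + 1), (i + 1, j), (i + 1, j + 1)} \<subseteq> S)"

definition start_square :: "square set \<Rightarrow> square" where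
  "start_square \<theta> = (THE x. x \<in> \<theta> \<and> (\<forall>y\<in>\<theta>. fst y \<le> fst x \<and> snd x \<le> snd y))"

definition end_square :: "square set \<Rightarrow> square" where
  "end_square \<theta> = (THE x. x \<in> \<theta> \<and> (\<forall>y\<in>\<theta>. fst x \<le> fst y \<and> snd y \<le> snd x))"

text \<open>Strips are nonempty, as \<open>partition_on\<close> excludes the empty block.\<close>

definition outside_decomposition :: "square set \<Rightarrow> square set set \<Rightarrow> bool" where
  "outside_decomposition S D \<longleftrightarrow> partition_on S D \<and>
     (\<forall>\<theta>\<in>D. border_strip \<theta> \<and>
        (left_of (start_square \<theta>) \<notin> S \<or> below (start_square \<theta>) \<notin> S) \<and>
        (right_of (end_square \<theta>) \<notin> S \<or> above (end_square \<theta>) \<notin> S))"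


section \<open>The cutting strip\<close>

definition diagonal_up :: "square set set \<Rightarrow> int \<Rightarrow> bool" where
  "diagonal_up D c \<longleftrightarrow> (\<exists>\<theta>\<in>D. \<exists>x\<in>\<theta>. content x = c \<and> above x \<in> \<theta>)"

definition diagonal_right :: "square set set \<Rightarrow> int \<Rightarrow> bool" where
  "diagonal_right D c \<longleftrightarrow> (\<exists>\<theta>\<in>D. \<exists>x\<in>\<theta>. content x = c \<and> right_of x \<in> \<theta>)"

definition contents :: "square set \<Rightarrow> int list" where
  "contents S = sorted_list_of_set (content ` S)"

text \<open>\<open>cutting_strip S D \<phi>\<close>: the list \<open>\<phi>\<close> enumerates the squares of a cutting strip, its \<open>i\<close>-th
  entry being the square to which the \<open>i\<close>-th smallest content of \<open>S\<close> is assigned; that content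
  need not be \<open>content (\<phi> ! i)\<close>, so the position of the strip in the quadrant is irrelevant.  A diagonal all of whose
  squares are ends of strips has no direction (this happens e.g. at the last diagonal of every
  connected component).  The step of \<open>\<phi>\<close> at such a diagonal is left unconstrained, so all
  conventions for choosing it are covered.\<close>

definition cutting_strip :: "square set \<Rightarrow> square set set \<Rightarrow> square list \<Rightarrow> bool" where
  "cutting_strip S D \<phi> \<longleftrightarrow>
     border_strip (set \<phi>) \<and> length \<phi> = length (contents S) \<and>
     (\<forall>i. Suc i < length \<phi> \<longrightarrow>
        (\<phi> ! Suc i = above (\<phi> ! i) \<or> \<phi> ! Suc i = right_of (\<phi> ! i)) \<and>
        (diagonal_up D (contents S ! i) \<longrightarrow> \<phi> ! Suc i = above (\<phi> ! i)) \<and>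
        (diagonal_right D (contents S ! i) \<longrightarrow> \<phi> ! Suc i = right_of (\<phi> ! i)))"

definition segment :: "square set \<Rightarrow> square list \<Rightarrow> int \<Rightarrow> int \<Rightarrow> square set" where
  "segment S \<phi> \<alpha> \<beta> =
     {\<phi> ! i | i. i < length \<phi> \<and> \<alpha> \<le> contents S ! i \<and> contents S ! i \<le> \<beta>}"


section \<open>Skew Schur functions\<close>

text \<open>A formal power series with integer coefficients in \<open>x\<^sub>1, x\<^sub>2, \<dots>\<close> is given by its coefficients;
  a monomial is the multiset of the indices of its variables.\<close>

type_synonym power_series = "nat multiset \<Rightarrow> int"

definition ps_zero :: power_series where
  "ps_zero = (\<lambda>m. 0)"

definition ps_one :: power_series where
  "ps_one = (\<lambda>m. if m = {#} then 1 else 0)"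

definition semistandard_tableaux :: "square set \<Rightarrow> (square \<Rightarrow> nat) set" where
  "semistandard_tableaux S = {T \<in> S \<rightarrow>\<^sub>E {1..}.
     (\<forall>x\<in>S. right_of x \<in> S \<longrightarrow> T x \<le> T (right_of x)) \<and>
     (\<forall>x\<in>S. below x \<in> S \<longrightarrow> T x < T (below x))}"

definition tableau_monomial :: "square set \<Rightarrow> (square \<Rightarrow> nat) \<Rightarrow> nat multiset" where
  "tableau_monomial S T = image_mset T (mset_set S)"

definition skew_schur :: "square set \<Rightarrow> power_series" where
  "skew_schur S = (\<lambda>m. int (card {T \<in> semistandard_tableaux S. tableau_monomial S T = m}))"


section \<open>The Hamel--Goulden matrix\<close>

definition schur_segment :: "square set \<Rightarrow> square list \<Rightarrow> int \<Rightarrow> int \<Rightarrow> power_series" where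
  "schur_segment S \<phi> \<alpha> \<beta> =
     (if \<alpha> \<le> \<beta> then skew_schur (segment S \<phi> \<alpha> \<beta>)
      else if \<alpha> = \<beta> + 1 then ps_one
      else ps_zero)"

definition G_matrix :: "square set \<Rightarrow> square list \<Rightarrow> square set list \<Rightarrow> power_series mat" where
  "G_matrix S \<phi> \<theta>s = mat (length \<theta>s) (length \<theta>s)
     (\<lambda>(i, j). schur_segment S \<phi> (content (start_square (\<theta>s ! i))) (content (end_square (\<theta>s ! j))))"

definition grank :: "square set \<Rightarrow> square list \<Rightarrow> square set list \<Rightarrow> nat" where
  "grank S \<phi> \<theta>s =
     (let G = G_matrix S \<phi> \<theta>s
      in card {i. i < dim_row G \<and> (\<forall>j < dim_col G. G $$ (i, j) \<noteq> ps_one)})"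

end

theory Submission
  imports Defs
begin

text \<open>Let \<open>n c\<close> be the number of squares of content \<open>c\<close>.  Both sides equal
  \<open>\<Sum>c. max 0 (n c - n (c - 1))\<close>.

  A row of the matrix contains a \<open>1\<close> iff some strip ends on the diagonal just before the one where
  the strip of the row starts, because the Schur function of a nonempty shape has no constant term.
  A strip occupies an interval of contents, once each, so the number of strips starting on diagonal
  \<open>c\<close> minus the number of strips ending on diagonal \<open>c - 1\<close> is \<open>n c - n (c - 1)\<close>.  If this is
  positive, then no square on diagonal \<open>c - 1\<close> lies on the right or top perimeter, so no strip ends
  there.  Hence exactly \<open>max 0 (n c - n (c - 1))\<close> rows without a \<open>1\<close> belong to strips starting on
  diagonal \<open>c\<close>.

  For the rank, let \<open>L c\<close> be \<open>1\<close> if the first square of diagonal \<open>c\<close> has its left neighbour outside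
  the diagram, and \<open>0\<close> otherwise.  The first square of diagonal \<open>c\<close> contributes with sign
  \<open>L c - L (c + 1)\<close>, and summation by parts turns \<open>\<Sum>c. (L c - L (c + 1)) * n c\<close> into
  \<open>\<Sum>c. L c * (n c - n (c - 1))\<close>.\<close>

section \<open>Diagonals of order-convex sets of squares\<close>

text \<open>Convexity in the componentwise order. The geometric arguments about diagonals and strips
  work with this property in place of the two partitions.\<close>

definition order_convex :: "square set \<Rightarrow> bool" where
  "order_convex S \<longleftrightarrow> (\<forall>i j k l u v. (i, j) \<in> S \<longrightarrow> (k, l) \<in> S \<longrightarrow>
     i \<le> u \<longrightarrow> u \<le> k \<longrightarrow> j \<le> v \<longrightarrow> v \<le> l \<longrightarrow> (u, v) \<in> S)"

lemma order_convexD: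
  assumes "order_convex S" "(i, j) \<in> S" "(k, l) \<in> S" "i \<le> u" "u \<le> k" "j \<le> v" "v \<le> l"
  shows "(u, v) \<in> S"
  using assms unfolding order_convex_def by blast

lemma young_diagram_downward:
  assumes "is_partition xs" "(k, l) \<in> young_diagram xs" "1 \<le> i" "i \<le> k" "1 \<le> j" "j \<le> l"
  shows "(i, j) \<in> young_diagram xs"
proof -
  have "xs ! nat (k - 1) \<le> xs ! nat (i - 1)"
  proof (cases "i = k")
    case False
    then show ?thesis
      using assms unfolding is_partition_def young_diagram_def
      by (auto intro!: sorted_wrt_nth_less[of "(\<ge>)" xs])
  qed simp
  then show ?thesis using assms unfolding young_diagram_def by auto
qed

lemma finite_young_diagram: "finite (young_diagram xs)"
proof (rule finite_subset)
  show "young_diagram xs \<subseteq> {1..int (length xs)} \<times> {1..int (sum_list xs)}"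
  proof (clarsimp simp: young_diagram_def)
    fix i j :: int assume "1 \<le> i" "i \<le> int (length xs)" "j \<le> int (xs ! nat (i - 1))"
    moreover from this have "xs ! nat (i - 1) \<le> sum_list xs"
      by (intro member_le_sum_list) auto
    ultimately show "j \<le> int (sum_list xs)" by linarith
  qed
qed simp

lemma finite_skew_diagram: "finite (skew_diagram lam mu)"
  by (simp add: skew_diagram_def finite_young_diagram)

text \<open>A difference of two order ideals of the positive quadrant is convex: membership in the
  larger one is inherited from \<open>(k, l)\<close>, non-membership in the smaller one from
  \<open>(i, j)\<close>.\<close>

lemma order_convex_skew_diagram:
  assumes "skew_partition lam mu"
  shows "order_convex (skew_diagram lam mu)"
  unfolding order_convex_def
proof (intro allI impI)
  fix i j k l u v
  assume a: "(i, j) \<in> skew_diagram lam mu" "(k, l) \<in> skew_diagram lam mu"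
    "i \<le> u" "u \<le> k" "j \<le> v" "v \<le> l"
  then have pos: "1 \<le> i" "1 \<le> j" by (auto simp: skew_diagram_def young_diagram_def)
  have "(u, v) \<in> young_diagram lam"
    using a pos assms young_diagram_downward[of lam k l u v]
    by (auto simp: skew_diagram_def skew_partition_def)
  moreover have "(u, v) \<notin> young_diagram mu"
    using a pos assms young_diagram_downward[of mu u v i j]
    by (auto simp: skew_diagram_def skew_partition_def)
  ultimately show "(u, v) \<in> skew_diagram lam mu" by (simp add: skew_diagram_def)
qed

section \<open>First squares and left-open diagonals\<close>

definition diagonal :: "square set \<Rightarrow> int \<Rightarrow> square set" where
  "diagonal S c = {x \<in> S. content x = c}"

definition first_squares :: "square set \<Rightarrow> square set" where
  "first_squares S = {(i, j). (i, j) \<in> S \<and> (i - 1, j - 1) \<notin> S}"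

text \<open>The existential form makes this false on an empty diagonal, which lets the summation by
  parts drop its boundary terms.\<close>

definition left_open :: "square set \<Rightarrow> int \<Rightarrow> bool" where
  "left_open S c \<longleftrightarrow> (\<exists>x \<in> first_squares S. content x = c \<and> left_of x \<notin> S)"

lemma finite_diagonal: "finite S \<Longrightarrow> finite (diagonal S c)"
  by (simp add: diagonal_def)

text \<open>Otherwise \<open>(i - 1, j - 1)\<close> lies between \<open>(k, l)\<close> and
  \<open>(i, j)\<close>, so convexity puts it into \<open>S\<close>.\<close>

lemma first_square_le:
  assumes "order_convex S" "(i, j) \<in> first_squares S" "(k, l) \<in> S" "l - k = j - i"
  shows "i \<le> k \<and> j \<le> l"
proof (rule ccontr)
  assume "\<not> (i \<le> k \<and> j \<le> l)"
  then have "k \<le> i - 1" "l \<le> j - 1" using assms(4) by linarith+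
  then have "(i - 1, j - 1) \<in> S"
    using order_convexD[OF assms(1,3), of i j "i - 1" "j - 1"] assms(2)
    by (auto simp: first_squares_def)
  then show False using assms(2) by (simp add: first_squares_def)
qed

lemma inj_on_content_first_squares:
  assumes "order_convex S"
  shows "inj_on content (first_squares S)"
proof (rule inj_onI)
  fix x y assume xy: "x \<in> first_squares S" "y \<in> first_squares S" "content x = content y"
  obtain i j k l where [simp]: "x = (i, j)" "y = (k, l)" by (metis surj_pair)
  have "(i, j) \<in> S" "(k, l) \<in> S" using xy by (auto simp: first_squares_def)
  then show "x = y"
    using first_square_le[OF assms, of i j k l] first_square_le[OF assms, of k l i j] xy by auto
qed

lemma first_square_exists:
  assumes "finite S" "x \<in> S"
  shows "\<exists>y \<in> first_squares S. content y = content x"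
proof -
  have fin: "finite (fst ` diagonal S (content x))"
    using assms by (simp add: finite_diagonal)
  have ne: "fst ` diagonal S (content x) \<noteq> {}" using assms(2) unfolding diagonal_def by blast
  obtain i j where y: "(i, j) \<in> diagonal S (content x)"
    and m: "i = Min (fst ` diagonal S (content x))"
    using Min_in[OF fin ne] by (metis (no_types, lifting) imageE prod.collapse)
  have "(i - 1, j - 1) \<notin> S"
  proof
    assume "(i - 1, j - 1) \<in> S"
    then have "(i - 1, j - 1) \<in> diagonal S (content x)" using y by (simp add: diagonal_def)
    then have "i \<le> i - 1" unfolding m using fin by (metis Min_le fst_conv imageI)
    then show False by simp
  qed
  then show ?thesis using y by (auto simp: first_squares_def diagonal_def)
qed

lemma content_first_squares:
  assumes "finite S"
  shows "content ` first_squares S = content ` S"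
proof
  show "content ` first_squares S \<subseteq> content ` S" unfolding first_squares_def by blast
  show "content ` S \<subseteq> content ` first_squares S"
  proof
    fix c assume "c \<in> content ` S"
    then obtain x where "x \<in> S" "c = content x" by blast
    then show "c \<in> content ` first_squares S"
      using first_square_exists[OF assms, of x] by (metis imageI)
  qed
qed

text \<open>\<open>corner_diagonal\<close> runs only to the south-east, but nothing of the diagonal
  precedes a first square. Corners are first squares, so the rank weights them by whole
  diagonals.\<close>

lemma corner_diagonal_first_square:
  assumes "order_convex S" "x \<in> first_squares S"
  shows "corner_diagonal S x = diagonal S (content x)"
proof -
  obtain i j where x: "x = (i, j)" by (cases x)
  show ?thesis
  proof (rule Set.set_eqI)
    fix y :: square
    obtain k l where y: "y = (k, l)" by (cases y)
    have "(k, l) \<in> corner_diagonal S (i, j)" if "(k, l) \<in> diagonal S (j - i)"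
    proof -
      define p where "p = k - i"
      have "k = i + p" "l = j + p" "(k, l) \<in> S"
        using that by (auto simp: p_def diagonal_def)
      then show ?thesis using first_square_le[OF assms(1), of i j k l] assms(2) by (auto simp: x)
    qed
    then show "y \<in> corner_diagonal S x \<longleftrightarrow> y \<in> diagonal S (content x)"
      unfolding x y by (auto simp: diagonal_def)
  qed
qed

lemma left_open_first_square:
  assumes "order_convex S" "x \<in> first_squares S"
  shows "left_open S (content x) \<longleftrightarrow> left_of x \<notin> S"
  using inj_onD[OF inj_on_content_first_squares[OF assms(1)]] assms(2)
  unfolding left_open_def by blast

text \<open>This moves the corner condition on \<open>above x\<close> to the next diagonal. If
  \<open>above x\<close> is in \<open>S\<close>, it is a first square whose left neighbour is the
  missing \<open>(i - 1, j - 1)\<close>; conversely, \<open>above x\<close> lies between the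
  left-open first square of the next diagonal and \<open>x\<close>.\<close>

lemma left_open_next:
  assumes "order_convex S" "x \<in> first_squares S"
  shows "left_open S (content x + 1) \<longleftrightarrow> above x \<in> S"
proof -
  obtain i j where x: "x = (i, j)" by (cases x)
  have xS: "(i, j) \<in> S" and nS: "(i - 1, j - 1) \<notin> S"
    using assms(2) by (auto simp: x first_squares_def)
  show ?thesis
  proof
    assume "above x \<in> S"
    then have ab: "(i - 1, j) \<in> S" by (simp add: x)
    have "(i - 2, j - 1) \<notin> S"
      using order_convexD[OF assms(1) _ xS, of "i - 2" "j - 1" "i - 1" "j - 1"] nS by auto
    then have "(i - 1, j) \<in> first_squares S" using ab by (simp add: first_squares_def)
    then show "left_open S (content x + 1)"
      using nS unfolding left_open_def by (intro bexI[of _ "(i - 1, j)"]) (auto simp: x)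
  next
    assume "left_open S (content x + 1)"
    then obtain k l where kl: "(k, l) \<in> first_squares S" "l - k = j - i + 1" "(k, l - 1) \<notin> S"
      unfolding left_open_def x by auto
    then have klS: "(k, l) \<in> S" by (simp add: first_squares_def)
    \<comment> \<open>From row \<open>i\<close> on, \<open>(k, l - 1)\<close> would lie between
      \<open>x\<close> and \<open>(k, l)\<close>.\<close>
    have "k < i"
    proof (rule ccontr)
      assume "\<not> k < i"
      then have "(k, l - 1) \<in> S"
        using order_convexD[OF assms(1) xS klS, of k "l - 1"] kl(2) by auto
      then show False using kl(3) by simp
    qed
    then show "above x \<in> S"
      using order_convexD[OF assms(1) klS xS, of "i - 1" j] kl(2) by (auto simp: x)
  qed
qed

section \<open>Comparison of neighbouring diagonals by shifts\<close>

lemma inj_left_of: "inj_on left_of A" and inj_above: "inj_on above A"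
  and inj_below: "inj_on below A"
  by (auto simp: inj_on_def)

text \<open>Shifting left is an injection between the diagonals: the left neighbour of a square lies
  between the left neighbour of the first square, which is in \<open>S\<close>, and the square
  itself.\<close>

lemma card_diagonal_not_left_open:
  assumes "finite S" "order_convex S" "\<not> left_open S c"
  shows "card (diagonal S c) \<le> card (diagonal S (c - 1))"
proof (rule card_inj_on_le[OF inj_left_of])
  show "left_of ` diagonal S c \<subseteq> diagonal S (c - 1)"
  proof (clarsimp simp: diagonal_def)
    fix k l assume kl: "(k, l) \<in> S" "c = l - k"
    obtain i j where ij: "(i, j) \<in> first_squares S" "j - i = l - k"
      using first_square_exists[OF assms(1) kl(1)] by auto
    have "(i, j - 1) \<in> S"
      using left_open_first_square[OF assms(2) ij(1)] assms(3) ij(2) kl(2) by simp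
    then show "(k, l - 1) \<in> S"
      using order_convexD[OF assms(2) _ kl(1), of i "j - 1" k "l - 1"]
        first_square_le[OF assms(2) ij(1) kl(1)] ij(2) by auto
  qed
qed (simp add: finite_diagonal assms)

text \<open>Shifting up is an injection here: the missing left neighbour of the first square forces
  diagonal \<open>c - 1\<close> into the rows below that square, and convexity then gives the
  squares above.\<close>

lemma card_diagonal_left_open:
  assumes "finite S" "order_convex S" "left_open S c"
  shows "card (diagonal S (c - 1)) \<le> card (diagonal S c)"
proof -
  obtain i j where ij: "(i, j) \<in> first_squares S" "c = j - i" "(i, j - 1) \<notin> S"
    using assms(3) unfolding left_open_def by auto
  have ijS: "(i, j) \<in> S" using ij by (simp add: first_squares_def)
  have "above x \<in> diagonal S c" if "x \<in> diagonal S (c - 1)" for x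
  proof -
    obtain k l where x: "x = (k, l)" by (cases x)
    have kl: "(k, l) \<in> S" "l - k = c - 1" using that by (simp_all add: x diagonal_def)
    have "i < k"
    proof (rule ccontr)
      assume "\<not> i < k"
      then have "(i, j - 1) \<in> S"
        using order_convexD[OF assms(2) kl(1) ijS, of i "j - 1"] kl(2) ij(2) by auto
      then show False using ij(3) by simp
    qed
    then show ?thesis
      using order_convexD[OF assms(2) ijS kl(1), of "k - 1" l] kl(2) ij(2)
      by (auto simp: x diagonal_def)
  qed
  then show ?thesis
    using assms(1) by (intro card_inj_on_le[OF inj_above]) (auto simp: finite_diagonal)
qed

text \<open>A perimeter square in row \<open>i\<close> confines diagonal \<open>c\<close>: to the
  rows above \<open>i\<close> if its right neighbour is missing, so that shifting down is an
  injection, and to the rows from \<open>i\<close> on if the square above it is missing, so that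
  shifting left is one.\<close>

lemma card_diagonal_perimeter:
  assumes "finite S" "order_convex S" "x \<in> diagonal S (c - 1)" "right_of x \<notin> S \<or> above x \<notin> S"
  shows "card (diagonal S c) \<le> card (diagonal S (c - 1))"
proof -
  obtain i j where x: "x = (i, j)" by (cases x)
  have ij: "(i, j) \<in> S" "j - i = c - 1" using assms(3) by (auto simp: x diagonal_def)
  show ?thesis
  proof (cases "right_of x \<in> S")
    case False
    then have ni: "(i, j + 1) \<notin> S" by (simp add: x)
    show ?thesis
    proof (rule card_inj_on_le[OF inj_below])
      show "below ` diagonal S c \<subseteq> diagonal S (c - 1)"
      proof (clarsimp simp: diagonal_def)
        fix k l assume kl: "(k, l) \<in> S" "c = l - k"
        have "k < i"
        proof (rule ccontr)
          assume "\<not> k < i"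
          then have "(i, j + 1) \<in> S"
            using order_convexD[OF assms(2) ij(1) kl(1), of i "j + 1"] kl(2) ij(2) by auto
          then show False using ni by simp
        qed
        then show "(k + 1, l) \<in> S"
          using order_convexD[OF assms(2) kl(1) ij(1), of "k + 1" l] kl(2) ij(2) by auto
      qed
    qed (simp add: finite_diagonal assms(1))
  next
    case True
    then have ni: "(i - 1, j) \<notin> S" using assms(4) by (simp add: x)
    show ?thesis
    proof (rule card_inj_on_le[OF inj_left_of])
      show "left_of ` diagonal S c \<subseteq> diagonal S (c - 1)"
      proof (clarsimp simp: diagonal_def)
        fix k l assume kl: "(k, l) \<in> S" "c = l - k"
        have "i \<le> k"
        proof (rule ccontr)
          assume "\<not> i \<le> k"
          then have "(i - 1, j) \<in> S"
            using order_convexD[OF assms(2) kl(1) ij(1), of "i - 1" j] kl(2) ij(2) by auto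
          then show False using ni by simp
        qed
        then show "(k, l - 1) \<in> S"
          using order_convexD[OF assms(2) ij(1) kl(1), of k "l - 1"] kl(2) ij(2) by auto
      qed
    qed (simp add: finite_diagonal assms(1))
  qed
qed


section \<open>The rank as a sum over diagonals\<close>

lemma skew_rank_eq_sum:
  assumes "finite S" "order_convex S"
  shows "skew_rank S =
    (\<Sum>c\<in>content ` S. max 0 (int (card (diagonal S c)) - int (card (diagonal S (c - 1)))))"
proof -
  define n where "n c = int (card (diagonal S c))" for c
  define L :: "int \<Rightarrow> int" where "L c = of_bool (left_open S c)" for c
  let ?F = "first_squares S" and ?C = "content ` S"
  have finF: "finite ?F" by (rule finite_subset[OF _ assms(1)]) (auto simp: first_squares_def)
  have corner: "(\<Sum>x\<in>X. int (card (corner_diagonal S x))) =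
      (\<Sum>x\<in>?F. of_bool (x \<in> X) * n (content x))" if "X \<subseteq> ?F" for X
  proof -
    have "(\<Sum>x\<in>X. int (card (corner_diagonal S x))) = (\<Sum>x\<in>X. of_bool (x \<in> X) * n (content x))"
    proof (rule sum.cong[OF refl])
      fix x assume "x \<in> X"
      moreover from this have "x \<in> ?F" using that by blast
      ultimately show "int (card (corner_diagonal S x)) = of_bool (x \<in> X) * n (content x)"
        using corner_diagonal_first_square[OF assms(2)] by (simp add: n_def)
    qed
    also have "\<dots> = (\<Sum>x\<in>?F. of_bool (x \<in> X) * n (content x))"
      by (rule sum.mono_neutral_left) (use that finF in auto)
    finally show ?thesis .
  qed
  \<comment> \<open>Outer corners have both neighbours missing (\<open>1 - 0\<close>), inner corners
    have both present (\<open>0 - 1\<close>); with exactly one present the two values of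
    \<open>L\<close> agree.\<close>
  have sign: "of_bool (x \<in> outer_corners S) - of_bool (x \<in> inner_corners S) =
      L (content x) - L (content x + 1)" if "x \<in> ?F" for x
    using that left_open_first_square[OF assms(2) that] left_open_next[OF assms(2) that]
    by (cases x) (auto simp: L_def outer_corners_def inner_corners_def first_squares_def)
  have L_imp: "c \<in> ?C" if "L c \<noteq> 0" for c
  proof -
    have "left_open S c" using that by (simp add: L_def)
    then show ?thesis unfolding left_open_def first_squares_def by blast
  qed
  have n_imp: "c \<in> ?C" if "n c \<noteq> 0" for c
  proof -
    have "diagonal S c \<noteq> {}" using that by (auto simp: n_def)
    then show ?thesis unfolding diagonal_def by blast
  qed
  have "skew_rank S = (\<Sum>x\<in>?F. of_bool (x \<in> outer_corners S) * n (content x)) -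
      (\<Sum>x\<in>?F. of_bool (x \<in> inner_corners S) * n (content x))"
    unfolding skew_rank_def
    by (subst (1 2) corner) (auto simp: outer_corners_def inner_corners_def first_squares_def)
  also have "\<dots> = (\<Sum>x\<in>?F. (L (content x) - L (content x + 1)) * n (content x))"
    unfolding sum_subtractf[symmetric]
    by (intro sum.cong refl) (simp only: sign[symmetric] left_diff_distrib)
  also have "\<dots> = (\<Sum>c\<in>content ` ?F. (L c - L (c + 1)) * n c)"
    by (simp add: sum.reindex inj_on_content_first_squares assms)
  also have "\<dots> = (\<Sum>c\<in>?C. L c * n c) - (\<Sum>c\<in>?C. L (c + 1) * n c)"
    by (simp add: content_first_squares assms left_diff_distrib sum_subtractf)
  also have "(\<Sum>c\<in>?C. L (c + 1) * n c) = (\<Sum>c\<in>(\<lambda>c. c + 1) ` ?C. L c * n (c - 1))"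
    by (simp add: sum.reindex)
  \<comment> \<open>The index sets may be exchanged because \<open>L c\<close> vanishes off
    \<open>?C\<close> and \<open>n (c - 1)\<close> vanishes off its shift.\<close>
  also have "\<dots> = (\<Sum>c\<in>?C. L c * n (c - 1))"
  proof (rule sum.mono_neutral_cong)
    show "L c * n (c - 1) = 0" if "c \<in> ?C - (\<lambda>c. c + 1) ` ?C" for c
    proof -
      have "c - 1 \<notin> ?C" using that by (metis DiffD2 diff_add_cancel imageI)
      then show ?thesis using n_imp by auto
    qed
  qed (use assms L_imp in auto)
  also have "(\<Sum>c\<in>?C. L c * n c) - \<dots> = (\<Sum>c\<in>?C. L c * (n c - n (c - 1)))"
    by (simp add: right_diff_distrib sum_subtractf)
  \<comment> \<open>The difference is at least \<open>0\<close> where \<open>L c\<close> is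
    \<open>1\<close> and at most \<open>0\<close> where \<open>L c\<close> is
    \<open>0\<close>.\<close>
  also have "\<dots> = (\<Sum>c\<in>?C. max 0 (n c - n (c - 1)))"
  proof (rule sum.cong[OF refl])
    fix c
    show "L c * (n c - n (c - 1)) = max 0 (n c - n (c - 1))"
      using card_diagonal_left_open[OF assms, of c] card_diagonal_not_left_open[OF assms, of c]
      by (cases "left_open S c") (simp_all add: L_def n_def)
  qed
  finally show ?thesis unfolding n_def .
qed


section \<open>Border strips\<close>

text \<open>Convexity would complete the two squares to a forbidden two by two block.\<close>

lemma border_strip_no_diagonal_step:
  assumes "border_strip T" "(i, j) \<in> T"
  shows "(i + 1, j + 1) \<notin> T"
proof
  assume a: "(i + 1, j + 1) \<in> T"
  have "order_convex T"
    using assms(1) order_convex_skew_diagram by (auto simp: border_strip_def is_skew_diagram_def)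
  then have "{(i, j), (i, j + 1), (i + 1, j), (i + 1, j + 1)} \<subseteq> T"
    using order_convexD[OF _ assms(2) a] a assms(2) by auto
  then show False using assms(1) unfolding border_strip_def by blast
qed

text \<open>Content orders a strip from its lower left to its upper right: a violation puts one
  square strictly north-west of the other, and convexity then yields a forbidden diagonal
  step.\<close>

lemma border_strip_content_mono:
  assumes "border_strip T" "x \<in> T" "y \<in> T" "content x \<le> content y"
  shows "fst y \<le> fst x \<and> snd x \<le> snd y"
proof -
  obtain i j k l where [simp]: "x = (i, j)" "y = (k, l)" by (metis surj_pair)
  have conv: "order_convex T"
    using assms(1) order_convex_skew_diagram by (auto simp: border_strip_def is_skew_diagram_def)
  have ij: "(i, j) \<in> T" and kl: "(k, l) \<in> T" using assms by auto
  have "\<not> i < k"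
  proof
    assume "i < k"
    then have "(i + 1, j + 1) \<in> T" using order_convexD[OF conv ij kl] assms(4) by auto
    then show False using border_strip_no_diagonal_step[OF assms(1) ij] by simp
  qed
  moreover have "\<not> l < j"
  proof
    assume "l < j"
    then have "(i - 1, j - 1) \<in> T" using order_convexD[OF conv kl ij] assms(4) by auto
    then show False using border_strip_no_diagonal_step[OF assms(1), of "i - 1" "j - 1"] ij by simp
  qed
  ultimately show ?thesis by simp
qed

lemma border_strip_content_inj: "border_strip T \<Longrightarrow> inj_on content T"
proof (rule inj_onI)
  fix x y assume "border_strip T" "x \<in> T" "y \<in> T" "content x = content y"
  then show "x = y"
    using border_strip_content_mono[of T x y] border_strip_content_mono[of T y x]
    by (simp add: prod_eq_iff)
qed

lemma finite_border_strip: "border_strip T \<Longrightarrow> finite T"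
  by (auto simp: border_strip_def is_skew_diagram_def finite_skew_diagram)

section \<open>Starting and ending squares as extrema of the content\<close>

lemma start_square_eq:
  assumes "border_strip T" "x \<in> T" "\<And>y. y \<in> T \<Longrightarrow> content x \<le> content y"
  shows "start_square T = x"
  unfolding start_square_def
proof (rule the_equality)
  show "x \<in> T \<and> (\<forall>y\<in>T. fst y \<le> fst x \<and> snd x \<le> snd y)"
    using border_strip_content_mono assms by blast
  show "z = x" if "z \<in> T \<and> (\<forall>y\<in>T. fst y \<le> fst z \<and> snd z \<le> snd y)" for z
    using that border_strip_content_mono[OF assms(1,2), of z] assms
    by (auto simp: prod_eq_iff intro: antisym)
qed

lemma end_square_eq:
  assumes "border_strip T" "x \<in> T" "\<And>y. y \<in> T \<Longrightarrow> content y \<le> content x"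
  shows "end_square T = x"
  unfolding end_square_def
proof (rule the_equality)
  show "x \<in> T \<and> (\<forall>y\<in>T. fst x \<le> fst y \<and> snd y \<le> snd x)"
    using border_strip_content_mono assms by blast
  show "z = x" if "z \<in> T \<and> (\<forall>y\<in>T. fst z \<le> fst y \<and> snd y \<le> snd z)" for z
    using that border_strip_content_mono[OF assms(1) _ assms(2), of z] assms
    by (auto simp: prod_eq_iff intro: antisym)
qed

lemma
  assumes "border_strip T" "T \<noteq> {}"
  shows start_square_in: "start_square T \<in> T"
    and content_start_square: "content (start_square T) = Min (content ` T)"
    and end_square_in: "end_square T \<in> T"
    and content_end_square: "content (end_square T) = Max (content ` T)"
proof -
  have fin: "finite (content ` T)" "content ` T \<noteq> {}"
    using assms finite_border_strip by auto
  obtain x where x: "x \<in> T" "content x = Min (content ` T)" using Min_in[OF fin] by auto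
  obtain y where y: "y \<in> T" "content y = Max (content ` T)" using Max_in[OF fin] by auto
  have s: "start_square T = x" using x fin by (intro start_square_eq assms) auto
  have e: "end_square T = y" using y fin by (intro end_square_eq assms) auto
  show "start_square T \<in> T" "content (start_square T) = Min (content ` T)"
    "end_square T \<in> T" "content (end_square T) = Max (content ` T)"
    using s e x y by auto
qed

lemma content_adjacent: "adjacent x y \<Longrightarrow> \<bar>content y - content x\<bar> = 1"
  by (cases x) (auto simp: adjacent_def)

text \<open>A discrete intermediate value argument: a path in \<open>T\<close> changes the content
  by one at each step.\<close>

lemma connected_content_intermediate:
  assumes "connected_squares T" "x \<in> T" "y \<in> T" "content x \<le> c" "c \<le> content y"
  shows "c \<in> content ` T"
proof -
  have "(x, y) \<in> {(a, b). a \<in> T \<and> b \<in> T \<and> adjacent a b}\<^sup>*"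
    using assms unfolding connected_squares_def by blast
  \<comment> \<open>The upper bound on \<open>c\<close> goes into the induction since it concerns
    the moving end of the path.\<close>
  then have "c \<le> content y \<longrightarrow> c \<in> content ` T"
  proof (induction rule: rtrancl_induct)
    case base
    then show ?case using assms(2,4) by (auto intro: rev_image_eqI)
  next
    case (step y z)
    show ?case
    proof
      assume c: "c \<le> content z"
      show "c \<in> content ` T"
      proof (cases "c \<le> content y")
        case True
        then show ?thesis using step.IH by blast
      next
        case False
        then have "c = content z" using c content_adjacent[of y z] step.hyps(2) by auto
        then show ?thesis using step.hyps(2) by auto
      qed
    qed
  qed
  then show ?thesis using assms(5) by blast
qed

lemma content_border_strip:
  assumes "border_strip T" "T \<noteq> {}"
  shows "content ` T = {content (start_square T)..content (end_square T)}"
proof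
  show "content ` T \<subseteq> {content (start_square T)..content (end_square T)}"
    using finite_border_strip[OF assms(1)]
    by (auto simp: content_start_square[OF assms] content_end_square[OF assms]
        simp del: content.simps)
  show "{content (start_square T)..content (end_square T)} \<subseteq> content ` T"
    using connected_content_intermediate[OF _ start_square_in[OF assms] end_square_in[OF assms]]
      assms(1) by (auto simp: border_strip_def)
qed

lemma card_diagonal_border_strip:
  assumes "border_strip T" "T \<noteq> {}"
  shows "card (diagonal T c) = of_bool (content (start_square T) \<le> c \<and> c \<le> content (end_square T))"
proof (cases "c \<in> content ` T")
  case True
  then obtain x where x: "x \<in> T" "content x = c" by blast
  then have "diagonal T c = {x}"
    using border_strip_content_inj[OF assms(1)] unfolding diagonal_def inj_on_def by blast
  then show ?thesis using True by (simp add: content_border_strip[OF assms])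
next
  case False
  then have "diagonal T c = {}" unfolding diagonal_def by blast
  then show ?thesis using False by (auto simp: content_border_strip[OF assms])
qed


section \<open>The rows of the Hamel--Goulden matrix\<close>

lemma card_diagonal_partition:
  assumes "partition_on S D" "finite S"
  shows "card (diagonal S c) = (\<Sum>T\<in>D. card (diagonal T c))"
proof -
  have "diagonal S c = (\<Union>T\<in>D. diagonal T c)"
    using assms(1) by (auto simp: diagonal_def partition_on_def)
  moreover have "card (\<Union>T\<in>D. diagonal T c) = (\<Sum>T\<in>D. card (diagonal T c))"
  proof (rule card_UN_disjoint)
    show "finite D" by (rule finite_elements[OF assms(2,1)])
    show "\<forall>T\<in>D. finite (diagonal T c)"
      using assms by (auto intro!: finite_diagonal simp: partition_on_def intro: finite_subset)
    show "\<forall>T\<in>D. \<forall>U\<in>D. T \<noteq> U \<longrightarrow> diagonal T c \<inter> diagonal U c = {}"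
      using assms(1) by (fastforce simp: diagonal_def partition_on_def disjoint_def)
  qed
  ultimately show ?thesis by simp
qed

text \<open>Diagonal \<open>c\<close> has one square for each strip whose content interval contains
  \<open>c\<close>; passing from \<open>c - 1\<close> to \<open>c\<close>, this count gains the
  starts at \<open>c\<close> and loses the ends at \<open>c - 1\<close>.\<close>

lemma card_starts_minus_ends:
  assumes "outside_decomposition S D" "finite S"
  shows "int (card {T \<in> D. content (start_square T) = c}) -
      int (card {T \<in> D. content (end_square T) = c - 1}) =
    int (card (diagonal S c)) - int (card (diagonal S (c - 1)))"
proof -
  have strip: "border_strip T" "T \<noteq> {}" if "T \<in> D" for T
    using assms(1) that by (auto simp: outside_decomposition_def partition_on_def)
  have part: "partition_on S D" using assms(1) by (simp add: outside_decomposition_def)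
  have finD: "finite D" by (rule finite_elements[OF assms(2) part])
  have "int (card (diagonal T c)) - int (card (diagonal T (c - 1))) =
      of_bool (content (start_square T) = c) - of_bool (content (end_square T) = c - 1)"
    if "T \<in> D" for T
  proof -
    have "content (start_square T) \<in> content ` T"
      using start_square_in[OF strip[OF that]] by blast
    \<comment> \<open>The jump formula relies on the content interval being nonempty.\<close>
    then have "content (start_square T) \<le> content (end_square T)"
      by (simp add: content_border_strip[OF strip[OF that]])
    then show ?thesis by (auto simp: card_diagonal_border_strip[OF strip[OF that]])
  qed
  then have "int (card (diagonal S c)) - int (card (diagonal S (c - 1))) =
      (\<Sum>T\<in>D. of_bool (content (start_square T) = c) - of_bool (content (end_square T) = c - 1))"
    by (simp add: card_diagonal_partition[OF part assms(2)] sum_subtractf[symmetric])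
  also have "\<dots> = int (card {T \<in> D. content (start_square T) = c}) -
      int (card {T \<in> D. content (end_square T) = c - 1})"
    using finD by (simp add: sum_subtractf Int_def)
  finally show ?thesis by simp
qed

text \<open>If a strip ends on diagonal \<open>c - 1\<close>, every start on \<open>c\<close> is
  matched and the perimeter condition makes the difference nonpositive. Otherwise every start on
  \<open>c\<close> is unmatched and their number is the difference.\<close>

lemma card_unmatched_starts:
  assumes "outside_decomposition S D" "finite S" "order_convex S"
  shows "int (card {T \<in> D. content (start_square T) = c \<and>
      (\<forall>U\<in>D. content (start_square T) \<noteq> content (end_square U) + 1)}) =
    max 0 (int (card (diagonal S c)) - int (card (diagonal S (c - 1))))"
proof (cases "\<exists>U\<in>D. content (end_square U) = c - 1")
  case True
  then obtain U where U: "U \<in> D" "content (end_square U) = c - 1" by blast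
  have "border_strip U" "U \<noteq> {}" "U \<subseteq> S" "right_of (end_square U) \<notin> S \<or> above (end_square U) \<notin> S"
    using assms(1) U(1) by (auto simp: outside_decomposition_def partition_on_def)
  then have "card (diagonal S c) \<le> card (diagonal S (c - 1))"
    using end_square_in[of U] U(2)
    by (intro card_diagonal_perimeter[OF assms(2,3), of "end_square U"]) (auto simp: diagonal_def)
  moreover have none: "{T \<in> D. content (start_square T) = c \<and>
      (\<forall>U\<in>D. content (start_square T) \<noteq> content (end_square U) + 1)} = {}"
    using U by force
  ultimately show ?thesis unfolding none by simp
next
  case False
  then have none: "{T \<in> D. content (end_square T) = c - 1} = {}" by blast
  have "{T \<in> D. content (start_square T) = c \<and>
      (\<forall>U\<in>D. content (start_square T) \<noteq> content (end_square U) + 1)} =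
      {T \<in> D. content (start_square T) = c}"
    using False by force
  then show ?thesis using card_starts_minus_ends[OF assms(1,2), of c] unfolding none by simp
qed

section \<open>Entries equal to \<open>1\<close> and the rows without them\<close>

lemma skew_schur_neq_one:
  assumes "finite S" "S \<noteq> {}"
  shows "skew_schur S \<noteq> ps_one"
proof
  assume "skew_schur S = ps_one"
  \<comment> \<open>The constant terms differ: a tableau of a nonempty finite shape has a nonempty
    monomial.\<close>
  then have "skew_schur S {#} = 1" by (simp add: ps_one_def)
  then show False
    using assms by (simp add: skew_schur_def tableau_monomial_def mset_set_empty_iff)
qed

text \<open>An empty segment would also give the series \<open>1\<close>. The assumption on \<alpha>
  rules this out when \<alpha> \<le> \<beta>, because the segment then contains the square assigned
  to \<alpha>.\<close>

lemma schur_segment_eq_one_iff: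
  assumes "finite S" "cutting_strip S D \<phi>" "\<alpha> \<in> content ` S"
  shows "schur_segment S \<phi> \<alpha> \<beta> = ps_one \<longleftrightarrow> \<alpha> = \<beta> + 1"
proof -
  have "ps_zero \<noteq> ps_one" by (auto simp: ps_zero_def ps_one_def fun_eq_iff)
  moreover have "skew_schur (segment S \<phi> \<alpha> \<beta>) \<noteq> ps_one" if "\<alpha> \<le> \<beta>"
  proof (rule skew_schur_neq_one)
    show "finite (segment S \<phi> \<alpha> \<beta>)"
      by (rule finite_subset[of _ "set \<phi>"]) (auto simp: segment_def)
    have "\<alpha> \<in> set (contents S)" using assms by (simp add: contents_def)
    then obtain i where "i < length \<phi>" "contents S ! i = \<alpha>"
      using assms(2) by (auto simp: in_set_conv_nth cutting_strip_def)
    then have "\<phi> ! i \<in> segment S \<phi> \<alpha> \<beta>" using that by (auto simp: segment_def)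
    then show "segment S \<phi> \<alpha> \<beta> \<noteq> {}" by blast
  qed
  ultimately show ?thesis by (auto simp: schur_segment_def)
qed

lemma grank_eq_card_unmatched:
  assumes "finite S" "distinct \<theta>s" "outside_decomposition S (set \<theta>s)"
    "cutting_strip S (set \<theta>s) \<phi>"
  shows "grank S \<phi> \<theta>s = card {T \<in> set \<theta>s.
    \<forall>U\<in>set \<theta>s. content (start_square T) \<noteq> content (end_square U) + 1}"
proof -
  let ?P = "\<lambda>T. \<forall>U\<in>set \<theta>s. content (start_square T) \<noteq> content (end_square U) + 1"
  have "content (start_square (\<theta>s ! i)) \<in> content ` S" if "i < length \<theta>s" for i
  proof -
    have "border_strip (\<theta>s ! i)" "\<theta>s ! i \<noteq> {}" "\<theta>s ! i \<subseteq> S"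
      using assms(3) nth_mem[OF that] by (auto simp: outside_decomposition_def partition_on_def)
    then show ?thesis using start_square_in by blast
  qed
  then have "grank S \<phi> \<theta>s = card {i. i < length \<theta>s \<and> ?P (\<theta>s ! i)}"
    unfolding grank_def Let_def G_matrix_def
    by (simp add: schur_segment_eq_one_iff[OF assms(1,4)] all_set_conv_all_nth cong: conj_cong)
  \<comment> \<open>Distinctness of the list lets row indices be replaced by strips.\<close>
  also have "\<dots> = card ((!) \<theta>s ` {i. i < length \<theta>s \<and> ?P (\<theta>s ! i)})"
    using assms(2) by (intro card_image[symmetric]) (auto simp: inj_on_def nth_eq_iff_index_eq)
  also have "(!) \<theta>s ` {i. i < length \<theta>s \<and> ?P (\<theta>s ! i)} = {T \<in> set \<theta>s. ?P T}"
    by (auto simp: in_set_conv_nth image_iff)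
  finally show ?thesis .
qed

lemma grank_eq_sum:
  assumes "finite S" "order_convex S" "distinct \<theta>s" "outside_decomposition S (set \<theta>s)"
    "cutting_strip S (set \<theta>s) \<phi>"
  shows "int (grank S \<phi> \<theta>s) =
    (\<Sum>c\<in>content ` S. max 0 (int (card (diagonal S c)) - int (card (diagonal S (c - 1)))))"
proof -
  let ?R = "{T \<in> set \<theta>s. \<forall>U\<in>set \<theta>s. content (start_square T) \<noteq> content (end_square U) + 1}"
  have "(\<lambda>T. content (start_square T)) ` ?R \<subseteq> content ` S"
  proof clarify
    fix T assume "T \<in> set \<theta>s"
    then have "border_strip T" "T \<noteq> {}" "T \<subseteq> S"
      using assms(4) by (auto simp: outside_decomposition_def partition_on_def)
    then show "content (start_square T) \<in> content ` S" using start_square_in by blast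
  qed
  \<comment> \<open>Grouping by starting diagonal: the fibres over the contents of \<open>S\<close>
    exhaust \<open>?R\<close>.\<close>
  then have "card ?R = (\<Sum>c\<in>content ` S. card {T \<in> ?R. content (start_square T) = c})"
    using assms(1) sum.group[of ?R "content ` S" "\<lambda>T. content (start_square T)" "\<lambda>_. 1 :: nat"]
    by simp
  also have "int \<dots> = (\<Sum>c\<in>content ` S.
      max 0 (int (card (diagonal S c)) - int (card (diagonal S (c - 1)))))"
    unfolding of_nat_sum
    by (intro sum.cong refl)
      (simp add: card_unmatched_starts[OF assms(4,1,2), symmetric] conj_commute conj_left_commute)
  finally show ?thesis by (simp add: grank_eq_card_unmatched[OF assms(1,3-5)])
qed

theorem theorem3p4:
  fixes lam mu :: "nat list"
    and \<theta>s :: "square set list"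
    and \<phi> :: "square list"
  assumes "skew_partition lam mu"
    and "distinct \<theta>s"
    and "outside_decomposition (skew_diagram lam mu) (set \<theta>s)"
    and "cutting_strip (skew_diagram lam mu) (set \<theta>s) \<phi>"
  shows "int (grank (skew_diagram lam mu) \<phi> \<theta>s) = skew_rank (skew_diagram lam mu)"
  using grank_eq_sum[OF finite_skew_diagram order_convex_skew_diagram[OF assms(1)] assms(2-4)]
    skew_rank_eq_sum[OF finite_skew_diagram order_convex_skew_diagram[OF assms(1)]]
  by simp

end
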